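(* Let $a,b\in\mathbb{R}$ with $a<b$ and $0\notin[a,b]$. Then for all $q\ge 1$: (a) if $q>1$ and $p=\frac{q}{q-1}$, then $$\left|A(a^{-1},b^{-1})-L^{-1}(a,b)\right|\le (b-a)\left(\frac{1}{p+1}\right)^{\frac1p}\left(\frac12\right)^{\frac1q}A\left(|a|^{-2},|b|^{-2}\right);$$ (b) $$\left|A(a^{-1},b^{-1})-L^{-1}(a,b)\right|\le (b-a)\left(\frac{3^{1-\frac1q}}{4}\right)A\left(|a|^{-2},|b|^{-2}\right).$$
   Context: For real $u,v$, $A(u,v)=\frac{u+v}{2}$ is the arithmetic mean. For real $a,b$ with $|a|\ne|b|$ and $ab\ne0$, the logarithmic mean is $L(a,b)=\frac{b-a}{\ln|b|-\ln|a|}$, and $L^{-1}(a,b)=1/L(a,b)$. *)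

theory Defs
  imports "HOL-Analysis.Analysis"
begin

definition arith_mean :: "real \<Rightarrow> real \<Rightarrow> real" where
  "arith_mean u v = (u + v) / 2"

text \<open>The logarithmic mean is meaningful for \<open>\<bar>a\<bar> \<noteq> \<bar>b\<bar>\<close> and \<open>a * b \<noteq> 0\<close>;
  outside this domain the value is a junk value.\<close>

definition log_mean :: "real \<Rightarrow> real \<Rightarrow> real" where
  "log_mean a b = (b - a) / (ln \<bar>b\<bar> - ln \<bar>a\<bar>)"

end

(* Both estimates follow from the trapezoid bound with constant 1/4, the value of the constant
   in (b) at q = 1: it is at most 3 powr (1 - 1/q) / 4, and the constant in (a) is at least
   1/2 * 1/2 because 1 + p \<le> 2 powr p for 1 \<le> p.  The trapezoid bound needs no
   integration: inserting 2 (b - a) / (a + b) \<le> ln b - ln a turns it into a polynomial inequality. *)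

theory Submission
  imports Defs
begin

text \<open>The error inside the absolute value is nonnegative, since the trapezoid rule
  overestimates the integral of the convex function \<open>1/x\<close>; only an upper bound
  remains.\<close>

lemma trapezoid_inverse_pos:
  fixes a b :: real
  assumes "0 < a" "a < b"
  shows "\<bar>(inverse a + inverse b) / 2 - (ln b - ln a) / (b - a)\<bar>
           \<le> (b - a) / 8 * (1 / a\<^sup>2 + 1 / b\<^sup>2)"
proof -
  have "ln b - ln a \<le> (b - a) * (inverse a + inverse b) / 2"
    using ln_inverse_approx_le[of a "b - a"] assms by simp
  hence nonneg: "0 \<le> (inverse a + inverse b) / 2 - (ln b - ln a) / (b - a)"
    using assms by (simp add: field_simps)
  \<comment> \<open>The midpoint rule underestimates the same integral; this replaces the logarithms
    by a rational function.\<close>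
  have "2 * (b - a) / (a + b) \<le> ln b - ln a"
    using ln_inverse_approx_ge[of a b] assms by (simp add: add.commute)
  hence "2 / (a + b) \<le> (ln b - ln a) / (b - a)"
    using assms by (simp add: field_simps)
  moreover have "(inverse a + inverse b) / 2 - 2 / (a + b) \<le> (b - a) / 8 * (1 / a\<^sup>2 + 1 / b\<^sup>2)"
  proof -
    \<comment> \<open>Completing the square in \<open>b\<^sup>2 - 3*a*b + 5*a\<^sup>2\<close>. The
      cubic is the numerator left when the claim is put over the common denominator
      \<open>8 * a\<^sup>2 * b\<^sup>2 * (a + b)\<close>.\<close>
    have "0 \<le> b * ((b - 3 / 2 * a)\<^sup>2 + 11 / 4 * a\<^sup>2) + a ^ 3"
      using assms by simp
    also have "\<dots> = (a + b) * (a\<^sup>2 + b\<^sup>2) - 4 * a * b * (b - a)"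
      by (simp add: power2_eq_square power3_eq_cube algebra_simps)
    finally have "0 \<le> (b - a) * ((a + b) * (a\<^sup>2 + b\<^sup>2) - 4 * a * b * (b - a)) / (8 * a\<^sup>2 * b\<^sup>2 * (a + b))"
      using assms by simp
    also have "\<dots> = (b - a) / 8 * (1 / a\<^sup>2 + 1 / b\<^sup>2) - ((inverse a + inverse b) / 2 - 2 / (a + b))"
      using assms by (simp add: divide_simps) (simp add: power2_eq_square algebra_simps)
    finally show ?thesis by simp
  qed
  ultimately show ?thesis using nonneg by linarith
qed

text \<open>Both endpoints have the same sign. The negative case reduces to the positive one by the
  reflection \<open>(a, b)\<close> to \<open>(-b, -a)\<close>, which only flips the sign of the
  error.\<close>

lemma trapezoid_inverse:
  fixes a b :: real
  assumes "a < b" "0 \<notin> {a..b}"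
  shows "\<bar>arith_mean (inverse a) (inverse b) - 1 / log_mean a b\<bar>
           \<le> (b - a) * (1 / 4) * arith_mean (\<bar>a\<bar> powi (-2)) (\<bar>b\<bar> powi (-2))"
proof (cases "0 < a")
  case True
  with assms trapezoid_inverse_pos[of a b] show ?thesis
    by (simp add: arith_mean_def log_mean_def power_int_minus inverse_eq_divide)
next
  case False
  with assms have neg: "b < 0" by auto
  have "\<bar>arith_mean (inverse a) (inverse b) - 1 / log_mean a b\<bar>
      = \<bar>(inverse (- b) + inverse (- a)) / 2 - (ln (- a) - ln (- b)) / (- a - - b)\<bar>"
  proof -
    have "arith_mean (inverse a) (inverse b) - 1 / log_mean a b
        = - ((inverse (- b) + inverse (- a)) / 2 - (ln (- a) - ln (- b)) / (- a - - b))"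
      using assms neg by (simp add: arith_mean_def log_mean_def divide_simps) (simp add: algebra_simps)
    thus ?thesis by (simp only: abs_minus_cancel)
  qed
  also have "\<dots> \<le> (- a - - b) / 8 * (1 / (- b)\<^sup>2 + 1 / (- a)\<^sup>2)"
    using assms neg by (intro trapezoid_inverse_pos) auto
  finally show ?thesis
    by (simp add: arith_mean_def power_int_minus inverse_eq_divide add.commute)
qed

text \<open>The convex function \<open>2 powr (p - 1)\<close> lies above its tangent at
  \<open>p = 1\<close>, whose slope \<open>ln 2\<close> is at least 1/2; doubling gives the
  claim.\<close>

lemma two_powr_ge:
  fixes p :: real
  assumes "1 \<le> p"
  shows "1 + p \<le> 2 powr p"
proof -
  have "1 / 2 \<le> ln (2 :: real)"
    using ln_le_minus_one[of "1 / 2"] by (simp add: ln_div)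
  hence "(p - 1) * (1 / 2) \<le> (p - 1) * ln 2"
    using assms by (intro mult_left_mono) auto
  also have "\<dots> \<le> exp ((p - 1) * ln 2) - 1"
    using exp_ge_add_one_self[of "(p - 1) * ln 2"] by linarith
  also have "\<dots> = 2 powr (p - 1) - 1"
    by (simp add: powr_def)
  finally show ?thesis
    by (simp add: powr_diff)
qed

text \<open>Each factor is at least 1/2: the first by taking \<open>p\<close>-th roots in
  \<open>1 + p \<le> 2 powr p\<close>, the second because \<open>1 / q \<le> 1\<close> and the base
  is below 1.\<close>

lemma hoelder_constant_ge:
  fixes p q :: real
  assumes "1 < q" "p = q / (q - 1)"
  shows "1 / 4 \<le> (1 / (p + 1)) powr (1 / p) * (1 / 2) powr (1 / q)"
proof -
  have p: "1 < p" using assms by (simp add: less_divide_eq)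
  have "1 + p \<le> 2 powr p"
    using two_powr_ge p by simp
  hence "(1 / 2) powr p \<le> 1 / (p + 1)"
    using p by (simp add: powr_divide field_simps)
  hence "((1 / 2) powr p) powr (1 / p) \<le> (1 / (p + 1)) powr (1 / p)"
    using p by (intro powr_mono2) auto
  hence "1 / 2 \<le> (1 / (p + 1)) powr (1 / p)"
    using p by (simp add: powr_powr)
  moreover have "(1 / 2) powr 1 \<le> (1 / 2 :: real) powr (1 / q)"
    using assms by (intro powr_mono') auto
  ultimately have "1 / 2 * (1 / 2) \<le> (1 / (p + 1)) powr (1 / p) * (1 / 2) powr (1 / q)"
    by (intro mult_mono) auto
  thus ?thesis by simp
qed

theorem proposition2:
  fixes a b q :: real
  assumes "a < b" and "0 \<notin> {a..b}" and "q \<ge> 1"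
  shows "(\<forall>p::real. q > 1 \<and> p = q / (q - 1) \<longrightarrow>
      \<bar>arith_mean (inverse a) (inverse b) - 1 / log_mean a b\<bar>
        \<le> (b - a) * (1 / (p + 1)) powr (1 / p) * (1 / 2) powr (1 / q)
            * arith_mean (\<bar>a\<bar> powi (-2)) (\<bar>b\<bar> powi (-2)))
    \<and> \<bar>arith_mean (inverse a) (inverse b) - 1 / log_mean a b\<bar>
        \<le> (b - a) * (3 powr (1 - 1 / q) / 4)
            * arith_mean (\<bar>a\<bar> powi (-2)) (\<bar>b\<bar> powi (-2))"
proof -
  let ?E = "\<bar>arith_mean (inverse a) (inverse b) - 1 / log_mean a b\<bar>"
  let ?M = "arith_mean (\<bar>a\<bar> powi (-2)) (\<bar>b\<bar> powi (-2))"
  \<comment> \<open>As \<open>b - a\<close> and \<open>?M\<close> are nonnegative, \<open>q\<close>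
    matters only through the constant.\<close>
  have weaken: "?E \<le> (b - a) * c * ?M" if "1 / 4 \<le> c" for c
  proof -
    have "0 \<le> ?M" by (simp add: arith_mean_def)
    hence "(b - a) * (1 / 4) * ?M \<le> (b - a) * c * ?M"
      using assms that by (intro mult_right_mono mult_left_mono) auto
    with trapezoid_inverse[OF assms(1,2)] show ?thesis by linarith
  qed
  have "1 \<le> (3 :: real) powr (1 - 1 / q)"
    using assms by (intro ge_one_powr_ge_zero) auto
  hence "1 / 4 \<le> (3 :: real) powr (1 - 1 / q) / 4" by simp
  note b = weaken[OF this]
  have a: "?E \<le> (b - a) * (1 / (p + 1)) powr (1 / p) * (1 / 2) powr (1 / q) * ?M"
    if "q > 1 \<and> p = q / (q - 1)" for p
    using weaken[OF hoelder_constant_ge[of q p]] that by (simp only: mult.assoc)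
  from a b show ?thesis by blast
qed

end
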